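(* Let $n\ge 1$ and $m\ge 1$ be integers and let $K$ be a field whose characteristic is either $0$ or a positive number relatively prime to $n$. Let $a,b\in K\setminus\{0\}$ with $a\ne b$, and let $\varepsilon$ be a primitive $n$-th root of unity. Let $\beta$ and $\gamma$ be arbitrary roots of the polynomials $x^n+a$ and $x^n+b$, respectively, in the splitting field of $(x^n+a)(x^n+b)$ over $K$. Let $x_i=\varepsilon^i\beta$ and $y_i=\varepsilon^i\gamma$ for $1\le i\le n$, let $\alpha=\beta^{-1}\gamma$, and for integers $r\ge 0$ and $k$ let $$f_{n,r}(k)=\sum_{i=0}^{n-1}\frac{\varepsilon^{ik}}{(1-\varepsilon^i\alpha)^r}.$$ Then $$\det\left(\left(\frac{1}{(x_i-y_j)^m}\right)_{1\le i,j\le n}\right)=(-1)^{mn}a^{-m}\alpha^{-\frac{n(n-1)}{2}}\, f_{n,m}(0)\prod_{k=1}^{n-1}\left[(-1)^m\binom{k-1}{m-1}n+\sum_{i=0}^{m-1}(-1)^i\binom{k}{i}f_{n,m-i}(0)\right].$$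
   Context: Binomial coefficients $\binom{k}{i}$ with $k,i\ge 0$ are $0$ when $i>k$; integers are interpreted in $K$ through the canonical map $\mathbb{Z}\to K$. Empty products equal $1$. *)

theory Defs
  imports
    "HOL-Computational_Algebra.Computational_Algebra"
    "Jordan_Normal_Form.Determinant"
begin

definition is_subfield :: "'l::field set \<Rightarrow> bool" where
  "is_subfield F \<longleftrightarrow> 0 \<in> F \<and> 1 \<in> F \<and>
     (\<forall>x\<in>F. \<forall>y\<in>F. x + y \<in> F \<and> x * y \<in> F) \<and>
     (\<forall>x\<in>F. - x \<in> F \<and> inverse x \<in> F)"

text \<open>
  The base field is the whole type \<open>'k\<close>, embedded by \<open>h\<close> into an ambient field \<open>'l\<close>;
  \<open>L\<close> is a subset of \<open>'l\<close>. Every splitting field arises in this way up to isomorphism, e.g.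
  inside an algebraic closure of \<open>'k\<close>, or with \<open>L = UNIV\<close> if \<open>'l\<close> is itself the splitting field.
\<close>
definition splitting_field :: "('k::field \<Rightarrow> 'l::field) \<Rightarrow> 'k poly \<Rightarrow> 'l set \<Rightarrow> bool" where
  "splitting_field h p L \<longleftrightarrow> field_hom h \<and> p \<noteq> 0 \<and>
     (\<exists>c xs. set xs \<subseteq> L \<and> map_poly h p = Polynomial.smult c (\<Prod>x\<leftarrow>xs. [:- x, 1:])) \<and>
     L = is_subfield hull (range h \<union> {x. poly (map_poly h p) x = 0})"

definition primitive_root_of_unity :: "nat \<Rightarrow> 'l::field \<Rightarrow> bool" where
  "primitive_root_of_unity n e \<longleftrightarrow> e ^ n = 1 \<and> (\<forall>k. 0 < k \<and> k < n \<longrightarrow> e ^ k \<noteq> 1)"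

definition f_sum :: "'l::field \<Rightarrow> 'l \<Rightarrow> nat \<Rightarrow> nat \<Rightarrow> int \<Rightarrow> 'l" where
  "f_sum e \<alpha> n r k = (\<Sum>i = 0..n - 1. e powi (int i * k) / (1 - e ^ i * \<alpha>) ^ r)"

definition binom_poly :: "nat \<Rightarrow> 'k::field \<Rightarrow> 'k poly" where
  "binom_poly n a = Polynomial.monom 1 n + [:a:]"

end

theory Submission
  imports Defs
begin

text \<open>
  Factoring \<open>x\<^sub>i\<close> out of \<open>x\<^sub>i - y\<^sub>j\<close> leaves \<open>1 - \<epsilon> ^ (j - i) * \<alpha>\<close>, so after pulling the factor
  \<open>1 / x\<^sub>i ^ m\<close> out of each row the matrix depends only on \<open>j - i\<close> modulo \<open>n\<close>: it is circulant.
  The columns of the Fourier matrix \<open>V = (\<epsilon> ^ (j * k))\<close> are eigenvectors of every circulant matrix,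
  and \<open>V\<close> is invertible because \<open>n\<close> does not vanish in the field. Hence the determinant is the
  product of the row factors and of the eigenvalues \<open>f\<^sub>m(k)\<close> for \<open>0 \<le> k < n\<close>
  (\<open>det_scaled_circulant\<close>). The row factors multiply to \<open>(- 1) ^ (m * n) / a ^ m\<close>, as the \<open>x\<^sub>i\<close> are
  all roots of \<open>x ^ n + a\<close> (\<open>prod_primitive_root_powers\<close>).

  It remains to express \<open>f\<^sub>m(k)\<close> through values at \<open>0\<close> (\<open>fourier_sum_reduction\<close>). With
  \<open>u\<^sub>i = 1 - \<epsilon> ^ i * \<alpha>\<close> one has \<open>\<epsilon> ^ (i * k) * \<alpha> ^ k = (1 - u\<^sub>i) ^ k\<close>. Expanding by the binomial
  theorem and dividing by \<open>u\<^sub>i ^ m\<close> gives a combination of sums of \<open>u\<^sub>i ^ (j - m)\<close> with \<open>j \<le> k\<close>.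
  For \<open>j < m\<close> such a sum is \<open>f\<^bsub>m-j\<^esub>(0)\<close>; for \<open>j \<ge> m\<close> it is the sum of a polynomial of degree
  less than \<open>n\<close> over the \<open>n\<close>-th roots of unity, which only sees the constant term and equals \<open>n\<close>.
  The coefficients of the second kind add up to a single binomial coefficient
  (\<open>alternating_choose_tail_sum\<close>). The powers \<open>\<alpha> ^ (- k)\<close> for \<open>1 \<le> k < n\<close> multiply to the power of
  \<open>\<alpha>\<close> in the formula.
\<close>

section \<open>Powers of a primitive root of unity\<close>

lemma primitive_root_of_unityD:
  assumes "primitive_root_of_unity n e"
  shows "e ^ n = 1" and "0 < k \<Longrightarrow> k < n \<Longrightarrow> e ^ k \<noteq> 1"
  using assms by (auto simp: primitive_root_of_unity_def)

lemma primitive_root_nonzero: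
  assumes "primitive_root_of_unity n e" and "n > 0"
  shows "e \<noteq> 0"
  using primitive_root_of_unityD(1)[OF assms(1)] assms(2) by (auto simp: power_0_left)

lemma power_mod_primitive_root:
  assumes "primitive_root_of_unity n e"
  shows "e ^ (k mod n) = e ^ k"
proof -
  have "e ^ k = e ^ (n * (k div n) + k mod n)" by simp
  also have "\<dots> = e ^ (k mod n)"
    by (simp only: power_add power_mult primitive_root_of_unityD(1)[OF assms] power_one mult_1)
  finally show ?thesis by simp
qed

lemma inj_on_powers_primitive_root:
  assumes "primitive_root_of_unity n e" and "n > 0"
  shows "inj_on (\<lambda>i. e ^ i) {..<n}"
proof (rule linorder_inj_onI)
  fix i j assume ij: "i < j" "i \<in> {..<n}" "j \<in> {..<n}"
  have "e ^ j = e ^ i * e ^ (j - i)"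
    using ij by (simp flip: power_add)
  moreover have "e ^ (j - i) \<noteq> 1"
    using ij by (intro primitive_root_of_unityD(2)[OF assms(1)]) auto
  ultimately show "e ^ i \<noteq> e ^ j"
    using primitive_root_nonzero[OF assms] by simp
qed auto

lemma sum_powers_root_of_unity_eq_0:
  fixes z :: "'a::field"
  assumes "z ^ n = 1" and "z \<noteq> 1"
  shows "(\<Sum>i<n. z ^ i) = 0"
  using assms by (simp add: geometric_sum)

text \<open>
  Division by a power of \<open>e\<close> permutes the group of \<open>n\<close>-th roots of unity. Since \<open>H\<close> is a function of
  the root and not of its exponent, cyclic shifts need no arithmetic modulo \<open>n\<close>.
\<close>
lemma sum_primitive_root_powers_shift:
  fixes e :: "'a::field"
  assumes "primitive_root_of_unity n e" and "n > 0"
  shows "(\<Sum>j<n. H (e ^ j / e ^ i)) = (\<Sum>j<n. H (e ^ j))"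
proof -
  define R where "R = (\<lambda>j. e ^ j) ` {..<n}"
  have e0: "e \<noteq> 0" using primitive_root_nonzero[OF assms] .
  have inR: "e ^ k \<in> R" for k
    unfolding R_def using power_mod_primitive_root[OF assms(1), of k] assms(2)
    by (metis image_eqI lessThan_iff mod_less_divisor)
  have sumR: "(\<Sum>j<n. g (e ^ j)) = (\<Sum>z\<in>R. g z)" for g :: "'a \<Rightarrow> 'b::comm_monoid_add"
    unfolding R_def by (subst sum.reindex[OF inj_on_powers_primitive_root[OF assms]]) simp
  have inj: "inj_on (\<lambda>z. z / e ^ i) R"
    using e0 by (auto intro: inj_onI)
  (* n * i - i is a natural number congruent to - i modulo n *)
  have inv: "1 / e ^ i = e ^ (n * i - i)"
  proof -
    have "e ^ i * e ^ (n * i - i) = e ^ (n * i)"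
      using assms(2) by (simp flip: power_add)
    also have "\<dots> = 1" by (simp add: power_mult primitive_root_of_unityD(1)[OF assms(1)])
    finally show ?thesis using e0 by (simp add: field_simps)
  qed
  have "(\<lambda>z. z / e ^ i) ` R \<subseteq> R"
  proof safe
    fix z assume "z \<in> R"
    then obtain j where "z = e ^ j" by (auto simp: R_def)
    hence "z / e ^ i = e ^ (j + (n * i - i))"
      using inv by (simp add: power_add divide_inverse)
    thus "z / e ^ i \<in> R" using inR by simp
  qed
  hence "(\<lambda>z. z / e ^ i) ` R = R"
    using inj by (intro endo_inj_surj) (auto simp: R_def)
  hence "(\<Sum>z\<in>R. H (z / e ^ i)) = (\<Sum>z\<in>R. H z)"
    using sum.reindex[OF inj, of H] by simp
  thus ?thesis by (simp add: sumR[of "\<lambda>z. H (z / e ^ i)"] sumR[of H])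
qed

text \<open>
  The exponents add up to \<open>n * (n + 1) / 2\<close>, a multiple of \<open>n\<close> for odd \<open>n\<close> and congruent to \<open>n / 2\<close>
  for even \<open>n\<close>; in the latter case \<open>e ^ (n / 2)\<close> is a square root of \<open>1\<close> other than \<open>1\<close>, thus \<open>- 1\<close>.
\<close>
lemma prod_primitive_root_powers:
  fixes e :: "'a::field"
  assumes "primitive_root_of_unity n e" and "n > 0"
  shows "(\<Prod>i<n. e ^ Suc i) = (- 1) ^ (n - 1)"
proof -
  have eq: "(\<Prod>i<n. e ^ Suc i) = e ^ (\<Sum>i<n. Suc i)"
    by (simp only: power_sum)
  have gauss: "2 * (\<Sum>i<n. Suc i) = n * (n + 1)" for n
    by (induction n) auto
  note e1 = primitive_root_of_unityD(1)[OF assms(1)]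
  show ?thesis
  proof (cases "even n")
    case True
    then obtain q where q: "n = 2 * q" by blast
    with assms(2) have "q > 0" by simp
    have "(\<Sum>i<n. Suc i) = n * q + q"
      using gauss[of n] q by (simp add: algebra_simps)
    hence "(\<Prod>i<n. e ^ Suc i) = e ^ q"
      by (simp only: eq power_add power_mult e1) simp
    moreover have "(e ^ q)\<^sup>2 = 1" using e1 q by (simp add: mult.commute flip: power_mult)
    moreover have "e ^ q \<noteq> 1"
      using q \<open>q > 0\<close> by (intro primitive_root_of_unityD(2)[OF assms(1)]) auto
    ultimately show ?thesis using True assms(2) by (simp add: power2_eq_1_iff)
  next
    case False
    then obtain q where q: "n = 2 * q + 1" by (elim oddE)
    have "(\<Sum>i<n. Suc i) = n * (q + 1)"
      using gauss[of n] q by (simp add: algebra_simps)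
    thus ?thesis using False by (simp only: eq power_mult e1) simp
  qed
qed

section \<open>The determinant of a circulant matrix\<close>

lemma det_mat_diag: "det (mat_diag n d) = (\<Prod>i<n. d i)"
  by (subst det_upper_triangular[of _ n])
     (auto simp: mat_diag_def prod_list_diag_prod atLeast0LessThan)

text \<open>
  By orthogonality of the characters of a cyclic group, the Fourier matrix times the matrix of its
  inverted entries is \<open>n\<close> times the identity.
\<close>
lemma det_fourier_matrix_nonzero:
  fixes e :: "'a::field"
  assumes e: "primitive_root_of_unity n e" and n: "of_nat n \<noteq> (0::'a)"
  shows "det (mat n n (\<lambda>(j, k). e ^ (j * k))) \<noteq> 0"
proof -
  define V where "V = mat n n (\<lambda>(j, k). e ^ (j * k))"
  define W where "W = mat n n (\<lambda>(j, k). inverse (e ^ (j * k)))"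
  have "n > 0" using n by (cases n) auto
  have e0: "e \<noteq> 0" using primitive_root_nonzero[OF e \<open>n > 0\<close>] .
  have orth: "(\<Sum>j<n. e ^ (i * j) * inverse (e ^ (j * k))) = (if i = k then of_nat n else 0)"
    if "i < n" "k < n" for i k
  proof -
    have "(\<Sum>j<n. e ^ (i * j) * inverse (e ^ (j * k))) = (\<Sum>j<n. (e ^ i / e ^ k) ^ j)"
      by (intro sum.cong)
         (simp_all add: divide_inverse power_mult_distrib power_inverse power_mult[symmetric] mult.commute)
    also have "\<dots> = (if i = k then of_nat n else 0)"
    proof (cases "i = k")
      case False
      have "e ^ i \<noteq> e ^ k"
        using inj_onD[OF inj_on_powers_primitive_root[OF e \<open>n > 0\<close>], of i k] False that by auto
      hence "e ^ i / e ^ k \<noteq> 1" using e0 by simp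
      moreover have "(e ^ i / e ^ k) ^ n = 1"
        by (simp add: power_divide power_commutes power_mult[symmetric] mult.commute[of _ n])
           (simp add: power_mult primitive_root_of_unityD(1)[OF e] e0)
      ultimately show ?thesis using False by (simp add: sum_powers_root_of_unity_eq_0)
    qed (simp add: e0)
    finally show ?thesis .
  qed
  have "V * W = mat_diag n (\<lambda>_. of_nat n)"
    by (rule eq_matI)
       (auto simp: V_def W_def mat_diag_def scalar_prod_def orth atLeast0LessThan)
  hence "det V * det W = of_nat n ^ n"
    using det_mult[of V n W] by (simp add: det_mat_diag V_def W_def)
  thus ?thesis using n unfolding V_def[symmetric] by auto
qed

text \<open>
  The eigenvector \<open>(e ^ (j * k))\<^sub>j\<close> of the circulant part has the eigenvalue \<open>l k\<close>. In matrix form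
  this reads \<open>M * V = diag r * V * diag l\<close>, where \<open>V\<close> is the Fourier matrix, and \<open>det V\<close> cancels.
\<close>
lemma det_scaled_circulant:
  fixes e :: "'a::field"
  assumes e: "primitive_root_of_unity n e" and n: "of_nat n \<noteq> (0::'a)"
  shows "det (mat n n (\<lambda>(i, j). r i * G (e ^ j / e ^ i))) =
           (\<Prod>i<n. r i) * (\<Prod>k<n. \<Sum>j<n. G (e ^ j) * (e ^ j) ^ k)"
proof -
  define M where "M = mat n n (\<lambda>(i, j). r i * G (e ^ j / e ^ i))"
  define V where "V = mat n n (\<lambda>(j, k). e ^ (j * k))"
  define l where "l k = (\<Sum>j<n. G (e ^ j) * (e ^ j) ^ k)" for k
  have "n > 0" using n by (cases n) auto
  have e0: "e \<noteq> 0" using primitive_root_nonzero[OF e \<open>n > 0\<close>] .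
  have carr: "M \<in> carrier_mat n n" "V \<in> carrier_mat n n"
    by (auto simp: M_def V_def)
  have eigen: "(\<Sum>j<n. r i * G (e ^ j / e ^ i) * e ^ (j * k)) = r i * (e ^ (i * k) * l k)" for i k
  proof -
    have "(\<Sum>j<n. r i * G (e ^ j / e ^ i) * e ^ (j * k)) =
            r i * (e ^ (i * k) * (\<Sum>j<n. G (e ^ j / e ^ i) * (e ^ j / e ^ i) ^ k))"
      unfolding sum_distrib_left
      by (intro sum.cong) (use e0 in \<open>simp_all add: power_divide power_mult\<close>)
    also have "(\<Sum>j<n. G (e ^ j / e ^ i) * (e ^ j / e ^ i) ^ k) = l k"
      unfolding l_def
      by (rule sum_primitive_root_powers_shift[OF e \<open>n > 0\<close>, of "\<lambda>z. G z * z ^ k"])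
    finally show ?thesis .
  qed
  have "M * V = mat_diag n r * (V * mat_diag n l)"
    unfolding mat_diag_mult_right[OF carr(2)]
    by (subst mat_diag_mult_left[of _ n n], simp, intro eq_matI)
       (auto simp: M_def V_def scalar_prod_def eigen atLeast0LessThan)
  hence "det M * det V = (\<Prod>i<n. r i) * (det V * (\<Prod>k<n. l k))"
    using carr by (simp add: det_mult[of _ n] det_mat_diag flip: det_mult[OF carr])
  moreover have "det V \<noteq> 0"
    unfolding V_def by (rule det_fourier_matrix_nonzero[OF e n])
  ultimately show ?thesis by (simp add: M_def l_def)
qed

section \<open>Reduction of the Fourier sums to the exponent zero\<close>

lemma alternating_choose_partial_sum:
  "(\<Sum>i\<le>m. (- 1) ^ i * of_nat (Suc k choose i)) =
     ((- 1) ^ m * of_nat (k choose m) :: 'a::comm_ring_1)"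
  by (induction m) (simp_all add: algebra_simps)

text \<open>
  The full alternating sum vanishes for \<open>k > 0\<close>, so the tail is minus the partial sum of the terms
  below \<open>m\<close>. For \<open>m > k\<close> both sides are \<open>0\<close>.
\<close>
lemma alternating_choose_tail_sum:
  assumes "k > 0" and "m > 0"
  shows "(\<Sum>i = m..k. (- 1) ^ i * of_nat (k choose i)) =
           ((- 1) ^ m * of_nat ((k - 1) choose (m - 1)) :: 'a::comm_ring_1)"
proof -
  obtain k' m' where km: "k = Suc k'" "m = Suc m'"
    using assms by (metis gr0_implies_Suc)
  let ?g = "\<lambda>i. (- 1) ^ i * of_nat (k choose i) :: 'a"
  have "(\<Sum>i\<in>{..m'} \<union> {m..k}. ?g i) = (\<Sum>i\<le>k. ?g i)"
    by (rule sum.mono_neutral_right) (auto simp: km binomial_eq_0 not_le intro: ccontr)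
  hence "(\<Sum>i\<le>m'. ?g i) + (\<Sum>i = m..k. ?g i) = (\<Sum>i\<le>k. ?g i)"
    by (subst (asm) sum.union_disjoint) (auto simp: km)
  moreover have "(\<Sum>i\<le>m'. ?g i) = (- 1) ^ m' * of_nat (k' choose m')"
    unfolding km by (rule alternating_choose_partial_sum)
  moreover have "(\<Sum>i\<le>k. ?g i) = 0"
    unfolding km alternating_choose_partial_sum by (simp add: binomial_eq_0)
  ultimately show ?thesis
    by (simp only: add_eq_0_iff) (simp add: km)
qed

text \<open>
  As \<open>p < n\<close>, the power sums of the \<open>n\<close>-th roots of unity kill every term of the binomial expansion
  except the constant term \<open>1\<close>.
\<close>
lemma sum_one_minus_power_primitive_root:
  fixes e :: "'a::field"
  assumes e: "primitive_root_of_unity n e" and p: "p < n"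
  shows "(\<Sum>i<n. (1 - e ^ i * \<alpha>) ^ p) = of_nat n"
proof -
  have "n > 0" using p by simp
  have zero: "(\<Sum>i<n. (e ^ i) ^ j) = (if j = 0 then of_nat n else 0)" if "j \<le> p" for j
  proof (cases "j = 0")
    case False
    have "(\<Sum>i<n. (e ^ j) ^ i) = 0"
    proof (rule sum_powers_root_of_unity_eq_0)
      show "(e ^ j) ^ n = 1"
        by (metis mult.commute power_mult power_one primitive_root_of_unityD(1)[OF e])
      show "e ^ j \<noteq> 1"
        using primitive_root_of_unityD(2)[OF e, of j] False that p by auto
    qed
    thus ?thesis using False by (simp add: mult.commute flip: power_mult)
  qed simp
  have "(\<Sum>i<n. (1 - e ^ i * \<alpha>) ^ p) =
          (\<Sum>i<n. \<Sum>j\<le>p. of_nat (p choose j) * (- \<alpha>) ^ j * (e ^ i) ^ j)"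
  proof (intro sum.cong refl)
    fix i
    have "(1 - e ^ i * \<alpha>) ^ p = ((- \<alpha>) * e ^ i + 1) ^ p"
      by (simp add: mult.commute)
    also have "\<dots> = (\<Sum>j\<le>p. of_nat (p choose j) * (- \<alpha>) ^ j * (e ^ i) ^ j)"
      unfolding binomial_ring power_mult_distrib by (simp add: mult.assoc)
    finally show "(1 - e ^ i * \<alpha>) ^ p = \<dots>" .
  qed
  also have "\<dots> = (\<Sum>j\<le>p. of_nat (p choose j) * (- \<alpha>) ^ j * (\<Sum>i<n. (e ^ i) ^ j))"
    by (subst sum.swap) (simp add: sum_distrib_left)
  also have "\<dots> = (\<Sum>j\<le>p. if j = 0 then of_nat n else 0)"
    by (intro sum.cong) (auto simp: zero)
  also have "\<dots> = of_nat n" by simp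
  finally show ?thesis .
qed

text \<open>
  With \<open>u i = 1 - e ^ i * \<alpha>\<close>, the identity \<open>(e ^ i * \<alpha>) ^ k = (1 - u i) ^ k\<close> turns the character
  \<open>(e ^ i) ^ k\<close> into a polynomial in \<open>u i\<close>. The terms of degree \<open>j < m\<close> lower the exponent of the
  denominator to \<open>m - j\<close>; those of degree \<open>j \<ge> m\<close> cancel the denominator and leave the power
  \<open>j - m < n\<close>, whose sum is \<open>n\<close>.
\<close>
lemma fourier_sum_reduction:
  fixes e :: "'a::field"
  assumes e: "primitive_root_of_unity n e" and \<alpha>: "\<alpha> \<noteq> 0"
    and nz: "\<And>i. 1 - e ^ i * \<alpha> \<noteq> 0"
    and k: "0 < k" "k < n" and m: "m > 0"
  shows "(\<Sum>i<n. 1 / (1 - e ^ i * \<alpha>) ^ m * (e ^ i) ^ k) =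
     inverse (\<alpha> ^ k) *
       ((- 1) ^ m * of_nat ((k - 1) choose (m - 1)) * of_nat n +
        (\<Sum>j<m. (- 1) ^ j * of_nat (k choose j) * (\<Sum>i<n. 1 / (1 - e ^ i * \<alpha>) ^ (m - j))))"
proof -
  define u where "u i = 1 - e ^ i * \<alpha>" for i
  define c where "c j = ((- 1) ^ j * of_nat (k choose j) :: 'a)" for j
  define T where "T j = (\<Sum>i<n. u i ^ j / u i ^ m)" for j
  have u0: "u i \<noteq> 0" for i using nz by (simp add: u_def)
  have low: "T j = (\<Sum>i<n. 1 / u i ^ (m - j))" if "j < m" for j
    unfolding T_def
    by (intro sum.cong) (use that u0 in \<open>auto simp: power_diff field_simps\<close>)
  have high: "T j = of_nat n" if "m \<le> j" "j \<le> k" for j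
  proof -
    have "T j = (\<Sum>i<n. u i ^ (j - m))"
      unfolding T_def by (intro sum.cong) (use that u0 in \<open>auto simp: power_diff\<close>)
    also have "\<dots> = of_nat n"
      unfolding u_def using that k by (intro sum_one_minus_power_primitive_root[OF e]) auto
    finally show ?thesis .
  qed
  have expand: "(e ^ i) ^ k = inverse (\<alpha> ^ k) * (\<Sum>j\<le>k. c j * u i ^ j)" for i
  proof -
    have "(e ^ i) ^ k * \<alpha> ^ k = (- u i + 1) ^ k"
      by (simp add: u_def power_mult_distrib)
    also have "\<dots> = (\<Sum>j\<le>k. c j * u i ^ j)"
      unfolding binomial_ring c_def
      by (intro sum.cong) (simp_all add: power_minus[of "u i"])
    finally show ?thesis using \<alpha> by (simp add: field_simps)
  qed
  have "(\<Sum>i<n. 1 / u i ^ m * (e ^ i) ^ k) =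
          (\<Sum>i<n. \<Sum>j\<le>k. inverse (\<alpha> ^ k) * (c j * (u i ^ j / u i ^ m)))"
    unfolding expand by (simp add: sum_distrib_left field_simps)
  also have "\<dots> = inverse (\<alpha> ^ k) * (\<Sum>j\<le>k. c j * T j)"
    by (subst sum.swap) (simp add: T_def sum_distrib_left)
  (* for m > k the index set grows, but only by indices with c j = 0 *)
  also have "(\<Sum>j\<le>k. c j * T j) = (\<Sum>j\<in>{..<m} \<union> {m..k}. c j * T j)"
    by (rule sum.mono_neutral_left) (auto simp: c_def binomial_eq_0)
  also have "\<dots> = (\<Sum>j<m. c j * T j) + (\<Sum>j = m..k. c j * T j)"
    by (rule sum.union_disjoint) auto
  also have "(\<Sum>j = m..k. c j * T j) = (\<Sum>j = m..k. c j) * of_nat n"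
    unfolding sum_distrib_right by (intro sum.cong) (auto simp: high)
  also have "(\<Sum>j = m..k. c j) = (- 1) ^ m * of_nat ((k - 1) choose (m - 1))"
    unfolding c_def by (rule alternating_choose_tail_sum[OF k(1) m])
  finally show ?thesis
    by (simp add: u_def c_def low add.commute)
qed

lemma f_sum_0:
  assumes "n > 0"
  shows "f_sum e \<alpha> n r 0 = (\<Sum>i<n. 1 / (1 - e ^ i * \<alpha>) ^ r)"
proof -
  have "{0..n - 1} = {..<n}" using assms by auto
  thus ?thesis by (simp add: f_sum_def)
qed

section \<open>Evaluation of the determinant\<close>

lemma field_hom_of_nat_nonzero:
  fixes h :: "'k::field \<Rightarrow> 'l::field"
  assumes "field_hom h" and "n > 0" and "CHAR('k) = 0 \<or> coprime CHAR('k) n"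
  shows "of_nat n \<noteq> (0::'l)"
proof
  interpret field_hom h by fact
  assume "of_nat n = (0::'l)"
  hence "h (of_nat n) = 0" by (simp add: hom_of_nat)
  hence "of_nat n = (0::'k)" by simp
  hence dvd: "CHAR('k) dvd n" by (simp add: of_nat_eq_0_iff_char_dvd)
  with assms(2,3) have "CHAR('k) = 1"
    by (metis coprime_absorb_left dvd_0_left_iff nat_neq_iff nat_dvd_1_iff_1)
  thus False by simp
qed

lemma poly_map_binom_poly:
  assumes "field_hom h"
  shows "poly (map_poly h (binom_poly n a)) z = z ^ n + h a"
proof -
  interpret field_hom h by fact
  have "map_poly h (binom_poly n a) = Polynomial.monom 1 n + [:h a:]"
    by (rule poly_eqI)
       (auto simp: binom_poly_def coeff_map_poly hom_distribs coeff_pCons split: nat.split)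
  thus ?thesis by (simp add: poly_monom)
qed

theorem theorem2:
  fixes n m :: nat
    and a b :: "'k::field"
    and h :: "'k \<Rightarrow> 'l::field"
    and L :: "'l set"
    and \<epsilon> \<beta> \<gamma> \<alpha> :: 'l
    and x y :: "nat \<Rightarrow> 'l"
    and f :: "nat \<Rightarrow> int \<Rightarrow> 'l"
  assumes "n \<ge> 1" and "m \<ge> 1"
    and "CHAR('k) = 0 \<or> coprime CHAR('k) n"
    and "a \<noteq> 0" and "b \<noteq> 0" and "a \<noteq> b"
    and "splitting_field h (binom_poly n a * binom_poly n b) L"
    and "primitive_root_of_unity n \<epsilon>"
    and "\<beta> \<in> L" and "poly (map_poly h (binom_poly n a)) \<beta> = 0"
    and "\<gamma> \<in> L" and "poly (map_poly h (binom_poly n b)) \<gamma> = 0"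
  defines "x \<equiv> \<lambda>i. \<epsilon> ^ i * \<beta>"
    and "y \<equiv> \<lambda>i. \<epsilon> ^ i * \<gamma>"
    and "\<alpha> \<equiv> inverse \<beta> * \<gamma>"
    and "f \<equiv> f_sum \<epsilon> \<alpha> n"
  shows "det (mat n n (\<lambda>(i, j). 1 / (x (i + 1) - y (j + 1)) ^ m)) =
    (- 1) ^ (m * n) * h a powi (- int m) * \<alpha> powi (- int (n * (n - 1) div 2)) * f m 0 *
    (\<Prod>k = 1..n - 1.
       (- 1) ^ m * of_nat ((k - 1) choose (m - 1)) * of_nat n +
       (\<Sum>i = 0..m - 1. (- 1) ^ i * of_nat (k choose i) * f (m - i) 0))"
proof -
  have n: "n > 0" and m: "m > 0" using assms by auto
  have hom: "field_hom h" using assms(7) by (simp add: splitting_field_def)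
  interpret field_hom h by fact
  have e: "primitive_root_of_unity n \<epsilon>" by fact
  have n0: "of_nat n \<noteq> (0::'l)"
    using field_hom_of_nat_nonzero[OF hom n] assms(3) by blast
  have e0: "\<epsilon> \<noteq> 0" using primitive_root_nonzero[OF e n] .
  have \<beta>: "\<beta> ^ n = - h a" and \<gamma>: "\<gamma> ^ n = - h b"
    using assms(10,12) by (simp_all add: poly_map_binom_poly[OF hom] eq_neg_iff_add_eq_0)
  have ha: "h a \<noteq> 0" "h b \<noteq> 0" "h a \<noteq> h b" using assms(4-6) by auto
  have \<beta>0: "\<beta> \<noteq> 0" and \<gamma>0: "\<gamma> \<noteq> 0"
    using \<beta> \<gamma> ha n by (auto simp: power_0_left)
  have \<alpha>0: "\<alpha> \<noteq> 0" using \<beta>0 \<gamma>0 by (simp add: \<alpha>_def)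
  (* a zero would give \<gamma> ^ n = \<beta> ^ n, hence a = b *)
  have nz: "1 - \<epsilon> ^ i * \<alpha> \<noteq> 0" for i
  proof
    assume "1 - \<epsilon> ^ i * \<alpha> = 0"
    hence "\<epsilon> ^ i * \<gamma> = \<beta>" using \<beta>0 by (simp add: \<alpha>_def field_simps)
    hence "(\<epsilon> ^ n) ^ i * \<gamma> ^ n = \<beta> ^ n"
      by (metis mult.commute power_mult power_mult_distrib)
    thus False using ha by (simp add: \<beta> \<gamma> primitive_root_of_unityD(1)[OF e])
  qed
  define B where "B k = (- 1) ^ m * of_nat ((k - 1) choose (m - 1)) * of_nat n +
       (\<Sum>i = 0..m - 1. (- 1) ^ i * of_nat (k choose i) * f (m - i) 0)" for k
  define l where "l k = (\<Sum>j<n. 1 / (1 - \<epsilon> ^ j * \<alpha>) ^ m * (\<epsilon> ^ j) ^ k)" for k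
  have f0: "f r 0 = (\<Sum>i<n. 1 / (1 - \<epsilon> ^ i * \<alpha>) ^ r)" for r
    unfolding f_def by (rule f_sum_0[OF n])
  have range_m: "{0..m - 1} = {..<m}" using m by auto
  have l_pos: "l k = inverse (\<alpha> ^ k) * B k" if "k \<in> {1..n - 1}" for k
    unfolding l_def B_def range_m f0
    using that by (intro fourier_sum_reduction[OF e \<alpha>0 nz _ _ m]) auto
  have gauss: "(\<Sum>k = 1..n - 1. k) = n * (n - 1) div 2"
    using Sum_Ico_nat[of 1 n] n
    by (simp add: atLeastLessThanSuc_atLeastAtMost[symmetric])
  have "(\<Prod>k<n. l k) = l 0 * (\<Prod>k = 1..n - 1. l k)"
  proof -
    have "{..<n} = insert 0 {1..n - 1}" using n by auto
    thus ?thesis by simp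
  qed
  also have "(\<Prod>k = 1..n - 1. l k) =
      inverse (\<alpha> ^ (n * (n - 1) div 2)) * (\<Prod>k = 1..n - 1. B k)"
  proof -
    have "(\<Prod>k = 1..n - 1. l k) = (\<Prod>k = 1..n - 1. inverse \<alpha> ^ k * B k)"
      by (intro prod.cong) (simp_all only: l_pos power_inverse)
    also have "\<dots> = inverse \<alpha> ^ (\<Sum>k = 1..n - 1. k) * (\<Prod>k = 1..n - 1. B k)"
      by (simp only: prod.distrib power_sum)
    finally show ?thesis by (simp only: gauss power_inverse)
  qed
  also have "l 0 = f m 0" by (simp add: l_def f0)
  finally have eigen:
    "(\<Prod>k<n. l k) = \<alpha> powi (- int (n * (n - 1) div 2)) * f m 0 * (\<Prod>k = 1..n - 1. B k)"
    by (simp add: power_int_minus mult_ac)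
  have "(\<Prod>i<n. x (i + 1)) = (- 1) ^ (n - 1) * (- h a)"
    using prod_primitive_root_powers[OF e n] by (simp add: x_def prod.distrib \<beta>)
  also have "\<dots> = (- 1) ^ n * h a"
    using n by (cases n) auto
  finally have prod_x: "(\<Prod>i<n. x (i + 1)) = (- 1) ^ n * h a" .
  have rows: "(\<Prod>i<n. 1 / x (i + 1) ^ m) = (- 1) ^ (m * n) * h a powi (- int m)"
  proof -
    have "(\<Prod>i<n. 1 / x (i + 1) ^ m) = inverse ((\<Prod>i<n. x (i + 1)) ^ m)"
      by (simp add: prod_inversef[symmetric] prod_power_distrib divide_inverse comp_def)
    also have "\<dots> = inverse (((- 1) ^ n) ^ m) * inverse (h a ^ m)"
      by (simp only: prod_x power_mult_distrib inverse_mult_distrib)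
    also have "inverse (((- 1) ^ n) ^ m) = ((- 1) ^ (m * n) :: 'l)"
      by (simp add: mult.commute flip: power_mult power_inverse)
    finally show ?thesis by (simp add: power_int_minus)
  qed
  have entry: "1 / (x (i + 1) - y (j + 1)) ^ m =
      1 / x (i + 1) ^ m * (1 / (1 - \<epsilon> ^ j / \<epsilon> ^ i * \<alpha>) ^ m)" for i j
  proof -
    have "x (i + 1) - y (j + 1) = x (i + 1) * (1 - \<epsilon> ^ j / \<epsilon> ^ i * \<alpha>)"
      using e0 \<beta>0 by (simp add: x_def y_def \<alpha>_def field_simps)
    thus ?thesis by (simp add: power_mult_distrib)
  qed
  have "det (mat n n (\<lambda>(i, j). 1 / (x (i + 1) - y (j + 1)) ^ m)) =
      (\<Prod>i<n. 1 / x (i + 1) ^ m) * (\<Prod>k<n. l k)"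
    unfolding entry l_def
    by (rule det_scaled_circulant[OF e n0, of "\<lambda>i. 1 / x (i + 1) ^ m" "\<lambda>z. 1 / (1 - z * \<alpha>) ^ m"])
  thus ?thesis
    unfolding rows eigen B_def by (simp only: mult.assoc)
qed

end
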